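(* Let $M$ be a finite-state transducer with $m$ states and $x$ an eventually linearly almost periodic sequence over its input alphabet such that $M(x)$ is infinite. Then $M(x)$ is eventually linearly almost periodic.
   Context: Sequences over a finite alphabet are maps $\mathbb{N}\to A$. A sequence $y$ is almost periodic if for each finite word $u$ occurring in $y$ there is $l$ such that every segment of $y$ of length $l$ contains $u$; its regulator $r_y(n)$ is the least $l$ such that every length-$n$ word occurring in $y$ occurs in every length-$l$ segment of $y$. $y$ is linearly almost periodic if it is almost periodic and there is a real $C\geqslant1$ with $r_y(n)\le Cn$ for all $n$; $y$ is eventually linearly almost periodic if some suffix $y(k)y(k+1)\dots$ is linearly almost periodic. A finite-state transducer $M=\langle A,B,Q,\tilde q,\lambda,\mu\rangle$ has finite state set $Q$, initial state $\tilde q$, $\lambda\colon Q\times A\to B^*$, $\mu\colon Q\times A\to Q$; its run on $x$ is $p_0=\tilde q$, $p_{n+1}=\mu(p_n,x(n))$, and $M(x)=\lambda(p_0,x(0))\lambda(p_1,x(1))\dots$. *)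

theory Defs
  imports Complex_Main "HOL-Library.Sublist" "HOL-Library.Omega_Words_Fun"
begin

(* Sequences are functions on nat, as in Omega_Words_Fun; y [i \<rightarrow> j] is the finite
   word y(i) ... y(j-1). *)

definition occurs_in :: "'a list \<Rightarrow> 'a word \<Rightarrow> bool" where
  "occurs_in u y \<longleftrightarrow> (\<exists>i. y [i \<rightarrow> i + length u] = u)"

definition almost_periodic :: "'a word \<Rightarrow> bool" where
  "almost_periodic y \<longleftrightarrow>
     (\<forall>u. occurs_in u y \<longrightarrow> (\<exists>l. \<forall>i. sublist u (y [i \<rightarrow> i + l])))"

(* The least element exists when y is almost periodic and takes finitely many values;
   the regulator is only meaningful in that case. *)
definition regulator :: "'a word \<Rightarrow> nat \<Rightarrow> nat" where
  "regulator y n =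
     (LEAST l. \<forall>u. length u = n \<longrightarrow> occurs_in u y \<longrightarrow> (\<forall>i. sublist u (y [i \<rightarrow> i + l])))"

definition linearly_almost_periodic :: "'a word \<Rightarrow> bool" where
  "linearly_almost_periodic y \<longleftrightarrow>
     almost_periodic y \<and> (\<exists>C::real. C \<ge> 1 \<and> (\<forall>n. real (regulator y n) \<le> C * real n))"

(* The qualified name is needed because Sublist also has a suffix (on lists). *)
definition eventually_linearly_almost_periodic :: "'a word \<Rightarrow> bool" where
  "eventually_linearly_almost_periodic y \<longleftrightarrow>
     (\<exists>k. linearly_almost_periodic (Omega_Words_Fun.suffix k y))"

record ('a, 'b, 'q) transducer =
  input_alphabet :: "'a set"
  output_alphabet :: "'b set"
  states :: "'q set"
  init_state :: 'q
  output_fun :: "'q \<Rightarrow> 'a \<Rightarrow> 'b list"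
  next_state :: "'q \<Rightarrow> 'a \<Rightarrow> 'q"

definition finite_state_transducer :: "('a, 'b, 'q) transducer \<Rightarrow> bool" where
  "finite_state_transducer M \<longleftrightarrow>
     finite (input_alphabet M) \<and> finite (output_alphabet M) \<and> finite (states M) \<and>
     init_state M \<in> states M \<and>
     (\<forall>q\<in>states M. \<forall>a\<in>input_alphabet M.
        output_fun M q a \<in> lists (output_alphabet M) \<and> next_state M q a \<in> states M)"

primrec run :: "('a, 'b, 'q) transducer \<Rightarrow> 'a word \<Rightarrow> 'q word" where
  "run M x 0 = init_state M"
| "run M x (Suc n) = next_state M (run M x n) (x n)"

definition output_upto :: "('a, 'b, 'q) transducer \<Rightarrow> 'a word \<Rightarrow> nat \<Rightarrow> 'b list" where
  "output_upto M x n = concat (map (\<lambda>i. output_fun M (run M x i) (x i)) [0..<n])"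

(* Since output_fun may return the empty word, the infinite concatenation M(x) can be finite.
   It is infinite iff the lengths of its finite approximations are unbounded. *)
definition infinite_output :: "('a, 'b, 'q) transducer \<Rightarrow> 'a word \<Rightarrow> bool" where
  "infinite_output M x \<longleftrightarrow> (\<forall>N. \<exists>n. length (output_upto M x n) \<ge> N)"

(* The infinite concatenation M(x) as a sequence, meaningful when infinite_output M x.
   The approximations output_upto M x n extend one another, so any n for which position j
   is already written gives the same letter. *)
definition transduce :: "('a, 'b, 'q) transducer \<Rightarrow> 'a word \<Rightarrow> 'b word" where
  "transduce M x j = output_upto M x (LEAST n. j < length (output_upto M x n)) ! j"

end

theory Submission
  imports Defs "HOL-Library.FuncSet"
begin

text \<open>
  Fix a factor \<open>w\<close> of length \<open>n\<close> and consider the transition maps on the state set that are read off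
  at the occurrences of \<open>w\<close> in a window. A prefix of \<open>x\<close> whose transition map has minimal rank
  resets the set of reachable states, so a copy of a window preceded by this prefix sees equally many
  maps. Hence every window of length \<open>L\<close> sees at most as many maps as any window of length \<open>K L\<close>.
  These numbers are bounded independently of \<open>w\<close>, so at some scale \<open>K ^ t * n\<close> with bounded \<open>t\<close>
  all windows see equally many maps, and then sliding the window shows that they all see the same
  maps. So the word of pairs (state, letter) is eventually linearly recurrent. Replacing letters by
  finite words, possibly empty, preserves this, since every window of bounded length emits a letter.
\<close>

section \<open>Linear almost periodicity as recurrence of positions\<close>

text \<open>Factors are named by a position \<open>i\<close> and a length \<open>n\<close>, and one
  natural constant bounds all window lengths, so later arguments avoid both word equations and the
  \<open>LEAST\<close> in \<open>regulator\<close>.\<close>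

definition linearly_recurrent :: "nat \<Rightarrow> 'a word \<Rightarrow> bool" where
  "linearly_recurrent C y \<longleftrightarrow>
     (\<forall>i j n. \<exists>k\<ge>j. k + n \<le> j + C * n \<and> (\<forall>d<n. y (k + d) = y (i + d)))"

lemma linearly_recurrentE:
  assumes "linearly_recurrent C y"
  obtains k where "j \<le> k" "k + n \<le> j + C * n" "\<And>d. d < n \<Longrightarrow> y (k + d) = y (i + d)"
  using assms unfolding linearly_recurrent_def by meson

text \<open>Recurrence at length 1 brings every letter into the first \<open>C\<close> positions.
  This later bounds the lengths of the words substituted for letters.\<close>

lemma linearly_recurrent_finite_range:
  assumes "linearly_recurrent C y"
  shows "finite (range y)"
proof -
  have "range y \<subseteq> y ` {..<C}"
  proof
    fix a assume "a \<in> range y"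
    then obtain i where i: "a = y i" by auto
    obtain k where "k + 1 \<le> 0 + C * 1" "\<And>d. d < 1 \<Longrightarrow> y (k + d) = y (i + d)"
      using linearly_recurrentE[OF assms] by metis
    then have "a = y k" "k < C"
      using i by auto
    then show "a \<in> y ` {..<C}"
      by blast
  qed
  then show ?thesis
    by (rule finite_subset) simp
qed

lemma subsequence_eq_iff:
  "y [i \<rightarrow> i + n] = y [k \<rightarrow> k + n] \<longleftrightarrow> (\<forall>d<n. y (i + d) = y (k + d))"
proof -
  have "y [i \<rightarrow> i + n] = map (\<lambda>d. y (i + d)) [0..<n]" for i
    by (intro nth_equalityI) auto
  then show ?thesis
    by auto
qed

lemma sublist_subsequence_iff:
  "sublist u (y [i \<rightarrow> i + l]) \<longleftrightarrow>
     (\<exists>k\<ge>i. k + length u \<le> i + l \<and> y [k \<rightarrow> k + length u] = u)"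
proof
  assume "sublist u (y [i \<rightarrow> i + l])"
  then obtain ps ss where eq: "y [i \<rightarrow> i + l] = ps @ u @ ss"
    by (auto simp: sublist_def)
  from arg_cong[OF this, of length] have len: "l = length ps + length u + length ss"
    by simp
  have "y (i + length ps + d) = u ! d" if "d < length u" for d
  proof -
    have "y (i + (length ps + d)) = y [i \<rightarrow> i + l] ! (length ps + d)"
      using that len by simp
    also have "\<dots> = u ! d"
      unfolding eq using that by (simp add: nth_append)
    finally show ?thesis by (simp add: add.assoc)
  qed
  then have "y [i + length ps \<rightarrow> i + length ps + length u] = u"
    by (intro nth_equalityI) auto
  then show "\<exists>k\<ge>i. k + length u \<le> i + l \<and> y [k \<rightarrow> k + length u] = u"
    using len by (intro exI[of _ "i + length ps"]) simp
next
  assume "\<exists>k\<ge>i. k + length u \<le> i + l \<and> y [k \<rightarrow> k + length u] = u"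
  then obtain k where k: "i \<le> k" "k + length u \<le> i + l" "y [k \<rightarrow> k + length u] = u"
    by blast
  obtain r where r: "i + l = k + length u + r"
    using k(2) le_iff_add by blast
  have "[i..<i + l] = [i..<k] @ [k..<k + length u] @ [k + length u..<i + l]"
    unfolding r using k(1) upt_add_eq_append[of i k "length u + r"]
      upt_add_eq_append[of k "k + length u" r] by (simp add: add.assoc)
  then have "y [i \<rightarrow> i + l] = y [i \<rightarrow> k] @ y [k \<rightarrow> k + length u] @ y [k + length u \<rightarrow> i + l]"
    unfolding subsequence_def by simp
  then show "sublist u (y [i \<rightarrow> i + l])"
    using k(3) by (metis sublist_def)
qed

lemma linearly_recurrent_imp_linearly_almost_periodic:
  assumes "linearly_recurrent C y"
  shows "linearly_almost_periodic y"
proof -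
  have *: "sublist u (y [i \<rightarrow> i + C * length u])" if occ: "occurs_in u y" for u i
  proof -
    obtain j where j: "y [j \<rightarrow> j + length u] = u"
      using occ unfolding occurs_in_def by blast
    obtain k where k: "i \<le> k" "k + length u \<le> i + C * length u"
      "\<And>d. d < length u \<Longrightarrow> y (k + d) = y (j + d)"
      using linearly_recurrentE[OF assms] by metis
    have "y [k \<rightarrow> k + length u] = u"
      using j k(3) by (metis subsequence_eq_iff)
    then show ?thesis
      using k(1,2) by (auto simp: sublist_subsequence_iff)
  qed
  have "almost_periodic y"
    unfolding almost_periodic_def using * by blast
  \<comment> \<open>\<open>C * n\<close> is a candidate for the least window length; the maximum
    with 1 meets the requirement that the real constant be at least 1.\<close>
  moreover have "real (regulator y n) \<le> max 1 (real C) * real n" for n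
  proof -
    have "regulator y n \<le> C * n"
      unfolding regulator_def using * by (intro Least_le) auto
    then have "real (regulator y n) \<le> real C * real n"
      by (metis of_nat_le_iff of_nat_mult)
    also have "\<dots> \<le> max 1 (real C) * real n"
      by (intro mult_right_mono) auto
    finally show ?thesis .
  qed
  ultimately show ?thesis
    unfolding linearly_almost_periodic_def by (meson max.cobounded1)
qed

text \<open>Finiteness of the range leaves finitely many factors of each length, so a common window
  length exists and \<open>regulator\<close> really has the property that its \<open>LEAST\<close>
  asks for.\<close>

lemma linearly_almost_periodic_imp_linearly_recurrent:
  assumes lap: "linearly_almost_periodic y" and fin: "finite (range y)"
  obtains C where "linearly_recurrent C y"
proof -
  define P where "P n l \<longleftrightarrow> (\<forall>u. length u = n \<longrightarrow> occurs_in u y \<longrightarrow> (\<forall>i. sublist u (y [i \<rightarrow> i + l])))"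
    for n l
  obtain c where c: "\<And>n. real (regulator y n) \<le> c * real n"
    using lap by (auto simp: linearly_almost_periodic_def)
  define C where "C = nat \<lceil>c\<rceil>"
  have bound: "regulator y n \<le> C * n" for n
  proof -
    have "c * real n \<le> real C * real n"
      unfolding C_def by (intro mult_right_mono) linarith+
    then have "real (regulator y n) \<le> real (C * n)"
      using c[of n] by simp
    then show ?thesis
      by (simp only: of_nat_le_iff)
  qed
  have ex: "\<exists>l. P n l" for n
  proof -
    let ?W = "{u. length u = n \<and> occurs_in u y}"
    have "?W \<subseteq> {u. set u \<subseteq> range y \<and> length u = n}"
    proof
      fix u assume u: "u \<in> ?W"
      then obtain i where "y [i \<rightarrow> i + length u] = u"
        unfolding occurs_in_def by blast
      moreover have "set (y [i \<rightarrow> i + length u]) \<subseteq> range y"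
        unfolding subsequence_def by auto
      ultimately show "u \<in> {u. set u \<subseteq> range y \<and> length u = n}"
        using u by simp
    qed
    then have W: "finite ?W"
      using finite_lists_length_eq[OF fin, of n] by (rule finite_subset)
    obtain L where L: "\<And>u i. occurs_in u y \<Longrightarrow> sublist u (y [i \<rightarrow> i + L u])"
      using lap unfolding linearly_almost_periodic_def almost_periodic_def by metis
    \<comment> \<open>The sum is merely a convenient common upper bound of the finitely many window
      lengths.\<close>
    have "P n (\<Sum>u\<in>?W. L u)"
      unfolding P_def
    proof (intro allI impI)
      fix u i assume u: "length u = n" "occurs_in u y"
      have "L u \<le> (\<Sum>u\<in>?W. L u)"
        using u W by (intro member_le_sum) auto
      then show "sublist u (y [i \<rightarrow> i + (\<Sum>u\<in>?W. L u)])"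
        using L[OF u(2), of i] by (fastforce simp: sublist_subsequence_iff)
    qed
    then show ?thesis ..
  qed
  have reg: "P n (regulator y n)" for n
    using LeastI_ex[OF ex] unfolding regulator_def P_def .
  have "linearly_recurrent C y"
    unfolding linearly_recurrent_def
  proof (intro allI)
    fix i j n
    let ?u = "y [i \<rightarrow> i + n]"
    have "occurs_in ?u y"
      unfolding occurs_in_def by (intro exI[of _ i]) simp
    then have "sublist ?u (y [j \<rightarrow> j + regulator y n])"
      using reg[of n] by (simp add: P_def)
    then obtain k where k: "j \<le> k" "k + n \<le> j + regulator y n" "y [k \<rightarrow> k + n] = ?u"
      by (auto simp: sublist_subsequence_iff)
    then show "\<exists>k\<ge>j. k + n \<le> j + C * n \<and> (\<forall>d<n. y (k + d) = y (i + d))"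
      using bound[of n] by (intro exI[of _ k]) (auto simp: subsequence_eq_iff)
  qed
  then show thesis by (rule that)
qed

section \<open>Transition maps of an automaton along a recurrent word\<close>

primrec reach :: "('q \<Rightarrow> 'a \<Rightarrow> 'q) \<Rightarrow> 'q \<Rightarrow> 'a word \<Rightarrow> nat \<Rightarrow> 'q" where
  "reach \<delta> q x 0 = q"
| "reach \<delta> q x (Suc n) = \<delta> (reach \<delta> q x n) (x n)"

lemma reach_add:
  "reach \<delta> q x (i + n) = reach \<delta> (reach \<delta> q x i) (Omega_Words_Fun.suffix i x) n"
  by (induction n) auto

lemma reach_cong:
  "(\<And>d. d < n \<Longrightarrow> x d = y d) \<Longrightarrow> reach \<delta> q x n = reach \<delta> q y n"
  by (induction n) auto

locale automaton_on_recurrent_word =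
  fixes Q :: "'q set" and \<delta> :: "'q \<Rightarrow> 'a \<Rightarrow> 'q" and x :: "'a word" and C :: nat
  assumes finite_Q: "finite Q"
    and closed: "\<And>q i. q \<in> Q \<Longrightarrow> \<delta> q (x i) \<in> Q"
    and recurrent: "linearly_recurrent C x"
begin

abbreviation "st q i \<equiv> reach \<delta> q x i"

text \<open>Restriction to \<open>Q\<close> identifies maps that agree on \<open>Q\<close>, so
  frames lie in a finite function space and can be counted.\<close>

definition "frame i = restrict (\<lambda>q. st q i) Q"

text \<open>Each map belongs to the whole prefix of \<open>x\<close> before the occurrence, not just
  to the part inside the window starting at \<open>j\<close>.\<close>

definition "frames i n L j =
  frame ` {k. j \<le> k \<and> k + n \<le> j + L \<and> (\<forall>d<n. x (k + d) = x (i + d))}"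

lemma st_closed: "q \<in> Q \<Longrightarrow> st q i \<in> Q"
  by (induction i) (auto simp: closed)

lemma frames_subset: "frames i n L j \<subseteq> Q \<rightarrow>\<^sub>E Q"
  unfolding frames_def frame_def using st_closed by auto

lemma finite_frames: "finite (frames i n L j)"
  using frames_subset finite_PiE[OF finite_Q, of "\<lambda>_. Q"] finite_Q by (metis finite_subset)

lemma st_image_add:
  "(\<lambda>q. st q (i + n)) ` Q = (\<lambda>q. reach \<delta> q (Omega_Words_Fun.suffix i x) n) ` (\<lambda>q. st q i) ` Q"
  by (simp add: reach_add image_image)

lemma st_image_repeat:
  assumes "\<And>d. d < n \<Longrightarrow> x (i + d) = x (j + d)" and "(\<lambda>q. st q i) ` Q \<subseteq> (\<lambda>q. st q j) ` Q"
  shows "(\<lambda>q. st q (i + n)) ` Q \<subseteq> (\<lambda>q. st q (j + n)) ` Q"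
proof -
  have "reach \<delta> q (Omega_Words_Fun.suffix i x) n = reach \<delta> q (Omega_Words_Fun.suffix j x) n" for q
    by (rule reach_cong) (simp add: assms(1))
  then show ?thesis
    unfolding st_image_add using assms(2) by auto
qed

text \<open>A prefix whose transition map has minimal rank resets the set of reachable states at each of
  its later occurrences.\<close>

lemma ex_resetting_prefix:
  obtains p where "\<And>i. \<forall>d<p. x (i + d) = x d \<Longrightarrow>
    (\<lambda>q. st q (i + p)) ` Q = (\<lambda>q. st q p) ` Q"
proof -
  obtain p where p: "\<And>i. card ((\<lambda>q. st q p) ` Q) \<le> card ((\<lambda>q. st q i) ` Q)"
    using ex_has_least_nat[of "\<lambda>_. True" 0 "\<lambda>i. card ((\<lambda>q. st q i) ` Q)"] by auto
  show thesis
  proof (rule that)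
    fix i assume "\<forall>d<p. x (i + d) = x d"
    \<comment> \<open>At position 0 the reachable set is all of \<open>Q\<close>, so it contains the
      one at \<open>i\<close>; reading the prefix keeps the inclusion, and minimal rank then forces
      equality.\<close>
    then have "(\<lambda>q. st q (i + p)) ` Q \<subseteq> (\<lambda>q. st q (0 + p)) ` Q"
      by (intro st_image_repeat) (auto simp: st_closed)
    then show "(\<lambda>q. st q (i + p)) ` Q = (\<lambda>q. st q p) ` Q"
      using finite_Q p by (intro card_seteq) auto
  qed
qed

text \<open>Each state reached at \<open>j\<close> is also reached at \<open>b\<close>, from a start
  state chosen by \<sigma>. Precomposition with \<sigma> then turns the frames at the copied
  positions into those of the window at \<open>j\<close>, so the latter are no more
  numerous.\<close>

lemma card_frames_le:
  assumes reach: "(\<lambda>q. st q j) ` Q \<subseteq> (\<lambda>q. st q b) ` Q"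
    and agree: "\<And>d. d < L \<Longrightarrow> x (b + d) = x (j + d)"
    and window: "j' \<le> b" "b + L \<le> j' + L'"
  shows "card (frames i n L j) \<le> card (frames i n L' j')"
proof -
  have "\<exists>q'. q' \<in> Q \<and> st q' b = st q j" if "q \<in> Q" for q
  proof -
    have "st q j \<in> (\<lambda>q. st q b) ` Q"
      using reach that by blast
    then show ?thesis
      by force
  qed
  then obtain \<sigma> where \<sigma>: "\<And>q. q \<in> Q \<Longrightarrow> \<sigma> q \<in> Q \<and> st (\<sigma> q) b = st q j"
    by metis
  have "frames i n L j \<subseteq> (\<lambda>h. restrict (h \<circ> \<sigma>) Q) ` frames i n L' j'"
  proof
    fix h assume "h \<in> frames i n L j"
    then obtain k where k: "h = frame k" "j \<le> k" "k + n \<le> j + L" "\<And>d. d < n \<Longrightarrow> x (k + d) = x (i + d)"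
      by (auto simp: frames_def)
    define e where "e = k - j"
    have e: "k = j + e" "e + n \<le> L"
      using k(2,3) by (auto simp: e_def)
    have "st (\<sigma> q) (b + e) = st q (j + e)" if "q \<in> Q" for q
      unfolding reach_add conjunct2[OF \<sigma>[OF that]]
      using e by (intro reach_cong) (simp add: agree)
    then have "h = restrict (frame (b + e) \<circ> \<sigma>) Q"
      using \<sigma> by (auto simp: frame_def k(1) e(1) fun_eq_iff)
    moreover have "x (b + e + d) = x (i + d)" if "d < n" for d
      using agree[of "e + d"] k(4)[OF that] that e by (simp add: add.assoc)
    then have "frame (b + e) \<in> frames i n L' j'"
      unfolding frames_def using window e by (intro imageI) auto
    ultimately show "h \<in> (\<lambda>h. restrict (h \<circ> \<sigma>) Q) ` frames i n L' j'"
      by blast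
  qed
  then show ?thesis
    using finite_frames by (meson card_image_le card_mono finite_imageI order_trans)
qed

lemma ex_card_frames_le:
  obtains c where "\<And>i n L j j'. c \<le> j \<Longrightarrow> card (frames i n L j) \<le> card (frames i n (C * (L + c)) j')"
proof -
  obtain p where p: "\<And>i. \<forall>d<p. x (i + d) = x d \<Longrightarrow>
    (\<lambda>q. st q (i + p)) ` Q = (\<lambda>q. st q p) ` Q"
    using ex_resetting_prefix by blast
  define c where "c = C * p"
  show thesis
  proof (rule that)
    fix i n L j j' assume j: "c \<le> j"
    \<comment> \<open>With \<open>c = C * p\<close> an occurrence of the resetting prefix fits
      between \<open>j - c\<close> and \<open>j\<close>. The window extended left to
      \<open>a\<close> has length at most \<open>L + c\<close>; its copy at \<open>a'\<close> starts
      with the same reset.\<close>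
    obtain a where a: "j - c \<le> a" "a + p \<le> j - c + C * p" "\<And>d. d < p \<Longrightarrow> x (a + d) = x (0 + d)"
      using linearly_recurrentE[OF recurrent] by metis
    have ap: "a + p \<le> j" "j \<le> a + c"
      using a(1,2) j by (auto simp: c_def)
    define l where "l = j + L - a"
    obtain a' where a': "j' \<le> a'" "a' + l \<le> j' + C * l" "\<And>d. d < l \<Longrightarrow> x (a' + d) = x (a + d)"
      using linearly_recurrentE[OF recurrent] by metis
    define e where "e = j - (a + p)"
    have e: "j = a + p + e" "l = p + e + L"
      using ap by (auto simp: e_def l_def)
    have le: "C * l \<le> C * (L + c)"
      using ap by (intro mult_le_mono) (auto simp: l_def)
    have window: "a' + p + e + L \<le> j' + C * (L + c)"
      using a'(2) le e(2) by linarith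
    have ia: "(\<lambda>q. st q (a + p)) ` Q = (\<lambda>q. st q p) ` Q"
      by (rule p) (use a(3) in simp)
    have ia': "(\<lambda>q. st q (a' + p)) ` Q = (\<lambda>q. st q p) ` Q"
      by (rule p) (use a(3) a'(3) e in simp)
    show "card (frames i n L j) \<le> card (frames i n (C * (L + c)) j')"
    proof (rule card_frames_le)
      show "(\<lambda>q. st q j) ` Q \<subseteq> (\<lambda>q. st q (a' + p + e)) ` Q"
        unfolding e(1)
      proof (rule st_image_repeat)
        fix d assume "d < e"
        then show "x (a + p + d) = x (a' + p + d)"
          using a'(3)[of "p + d"] e by (simp add: add.assoc)
      qed (simp add: ia ia')
      show "x (a' + p + e + d) = x (j + d)" if "d < L" for d
        using a'(3)[of "p + e + d"] e that by (simp add: add.assoc)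
    qed (use a'(1) window in auto)
  qed
qed

text \<open>If the number of frames depended on the window at every scale up to the number of all maps
  on \<open>Q\<close>, it would exceed that number.\<close>

lemma ex_frame_scale:
  obtains c K N where "\<forall>i. \<forall>n>0. \<exists>t\<le>N. \<forall>j\<ge>c. \<forall>j'\<ge>c.
      card (frames i n (K ^ Suc t * n) j') \<le> card (frames i n (K ^ t * n) j)"
    and "2 \<le> K"
proof -
  obtain c where c: "\<And>i n L j j'. c \<le> j \<Longrightarrow>
      card (frames i n L j) \<le> card (frames i n (C * (L + c)) j')"
    using ex_card_frames_le by blast
  \<comment> \<open>The factor \<open>1 + c\<close> absorbs the additive \<open>c\<close>, since
    \<open>K ^ t * n\<close> is at least 1. The summand 2 makes the next scale strictly longer,
    which sliding a window by one position needs.\<close>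
  define K where "K = C * (1 + c) + 2"
  define N where "N = card (Q \<rightarrow>\<^sub>E Q)"
  have mono: "frames i n L j \<subseteq> frames i n L' j" if "L \<le> L'" for i n L L' j
    unfolding frames_def using that by auto
  have key: "card (frames i n (K ^ t * n) j) \<le> card (frames i n (K ^ Suc t * n) j')"
    if "c \<le> j" "0 < n" for i n t j j'
  proof -
    have L: "1 \<le> K ^ t * n"
      using that by (simp add: K_def Suc_leI)
    have "C * (K ^ t * n + c) \<le> C * ((1 + c) * (K ^ t * n))"
      using mult_le_mono2[OF L, of c] by (intro mult_le_mono2) (simp add: algebra_simps)
    also have "\<dots> \<le> K * (K ^ t * n)"
      unfolding K_def by (simp add: algebra_simps)
    also have "\<dots> = K ^ Suc t * n"
      by simp
    finally have "card (frames i n (C * (K ^ t * n + c)) j') \<le> card (frames i n (K ^ Suc t * n) j')"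
      by (intro card_mono finite_frames mono)
    then show ?thesis
      using c[OF that(1), of i n "K ^ t * n" j'] by linarith
  qed
  show thesis
  proof (rule that)
    show "2 \<le> K" by (simp add: K_def)
    show "\<forall>i. \<forall>n>0. \<exists>t\<le>2 * N. \<forall>j\<ge>c. \<forall>j'\<ge>c.
      card (frames i n (K ^ Suc t * n) j') \<le> card (frames i n (K ^ t * n) j)"
    proof (intro allI impI, rule ccontr)
      fix i n :: nat assume n: "0 < n"
      assume "\<not> (\<exists>t\<le>2 * N. \<forall>j\<ge>c. \<forall>j'\<ge>c.
        card (frames i n (K ^ Suc t * n) j') \<le> card (frames i n (K ^ t * n) j))"
      then have no: "\<exists>j\<ge>c. \<exists>j'\<ge>c.
          card (frames i n (K ^ t * n) j) < card (frames i n (K ^ Suc t * n) j')" if "t \<le> 2 * N" for t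
        using that by (meson not_le)
      \<comment> \<open>Each increase costs two scales: one yields a larger count in some window
        \<open>j1\<close>, and the next, by \<open>key\<close>, carries that count to every window.
        Hence the bound \<open>2 * N\<close> on the scale.\<close>
      have "\<forall>j\<ge>c. s \<le> card (frames i n (K ^ (2 * s) * n) j)" if "s \<le> Suc N" for s
        using that
      proof (induction s)
        case (Suc s)
        then obtain j0 j1 where j: "c \<le> j0" "c \<le> j1"
          "card (frames i n (K ^ (2 * s) * n) j0) < card (frames i n (K ^ Suc (2 * s) * n) j1)"
          using no[of "2 * s"] by auto
        then have "Suc s \<le> card (frames i n (K ^ Suc (2 * s) * n) j1)"
          using Suc by (meson Suc_leD Suc_leI le_less_trans)
        also have "\<dots> \<le> card (frames i n (K ^ Suc (Suc (2 * s)) * n) j)" for j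
          by (rule key) (use j n in auto)
        finally show ?case by simp
      qed simp
      then have "Suc N \<le> card (frames i n (K ^ (2 * Suc N) * n) c)"
        by blast
      also have "\<dots> \<le> N"
        unfolding N_def using finite_Q by (intro card_mono frames_subset finite_PiE) auto
      finally show False by simp
    qed
  qed
qed

text \<open>Evaluating equal frames at \<open>q\<close> gives equal states at the starts of two
  occurrences. The first \<open>c\<close> positions are dropped because the comparison of windows
  needs room for the resetting prefix.\<close>

lemma state_recurrence:
  assumes "q \<in> Q"
  obtains c D where "linearly_recurrent D (Omega_Words_Fun.suffix c (\<lambda>i. (st q i, x i)))"
proof -
  obtain c K N where scale: "\<forall>i. \<forall>n>0. \<exists>t\<le>N. \<forall>j\<ge>c. \<forall>j'\<ge>c.
      card (frames i n (K ^ Suc t * n) j') \<le> card (frames i n (K ^ t * n) j)"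
    and K: "2 \<le> K"
    by (rule ex_frame_scale)
  have "linearly_recurrent (K ^ N) (Omega_Words_Fun.suffix c (\<lambda>i. (st q i, x i)))"
    unfolding linearly_recurrent_def
  proof (intro allI)
    fix i j n :: nat
    let ?z = "Omega_Words_Fun.suffix c (\<lambda>i. (st q i, x i))"
    show "\<exists>k\<ge>j. k + n \<le> j + K ^ N * n \<and> (\<forall>d<n. ?z (k + d) = ?z (i + d))"
    proof (cases "n = 0")
      case False
      then obtain t where t: "t \<le> N" and le: "\<And>j j'. c \<le> j \<Longrightarrow> c \<le> j' \<Longrightarrow>
          card (frames (c + i) n (K ^ Suc t * n) j') \<le> card (frames (c + i) n (K ^ t * n) j)"
        using scale[rule_format, of n "c + i"] by blast
      define L where "L = K ^ t * n"
      define L' where "L' = K ^ Suc t * n"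
      define F where "F = frames (c + i) n L"
      define F' where "F' = frames (c + i) n L'"
      have L: "n \<le> L" "Suc L \<le> L'"
      proof -
        show "n \<le> L"
          using K by (simp add: L_def)
        then have "Suc L \<le> 2 * L"
          using False by simp
        also have "\<dots> \<le> K * L"
          using K by (rule mult_le_mono1)
        finally show "Suc L \<le> L'"
          by (simp add: L_def L'_def)
      qed
      \<comment> \<open>At the chosen scale no long window has more frames than a short one, so an
        inclusion between them is an equality.\<close>
      have F_eq: "F j = F' j'" if "c \<le> j" "c \<le> j'" "F j \<subseteq> F' j'" for j j'
        using that le[of j j'] finite_frames unfolding F_def F'_def L_def L'_def
        by (intro card_seteq) auto
      \<comment> \<open>Both short windows lie in the long window at \<open>j\<close>, as
        \<open>L'\<close> is at least \<open>L + 1\<close>; hence both frame sets equal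
        \<open>F' j\<close>.\<close>
      have "F (Suc j) = F j" if "c \<le> j" for j
      proof -
        have "F j \<subseteq> F' j" "F (Suc j) \<subseteq> F' j"
          unfolding F_def F'_def frames_def using L(2) by auto
        then show ?thesis
          using F_eq[of j j] F_eq[of "Suc j" j] that by simp
      qed
      then have const: "F (c + e) = F c" for e
        by (induction e) auto
      have "frame (c + i) \<in> F (c + i)"
        unfolding F_def frames_def using L(1) by (intro imageI) auto
      then have "frame (c + i) \<in> F (c + j)"
        by (simp add: const)
      then obtain k where k: "frame (c + i) = frame k" "c + j \<le> k" "k + n \<le> c + j + L"
        "\<And>d. d < n \<Longrightarrow> x (k + d) = x (c + i + d)"
        unfolding F_def frames_def by auto
      have st: "st q k = st q (c + i)"
        using fun_cong[OF k(1), of q] assms by (simp add: frame_def)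
      have "L \<le> K ^ N * n"
        unfolding L_def using t K by (intro mult_le_mono1 power_increasing) auto
      \<comment> \<open>Equal states at the start and equal letters afterwards keep the states
        equal.\<close>
      moreover have "st q (k + d) = st q (c + i + d)" if "d < n" for d
        unfolding reach_add st using that k(4) by (intro reach_cong) simp
      ultimately show ?thesis
        using k by (intro exI[of _ "k - c"]) (auto simp: add.assoc)
    qed auto
  qed
  then show thesis by (rule that)
qed

end

section \<open>Replacing letters by possibly empty words\<close>

text \<open>\<open>pos i\<close> is where the block of \<open>z i\<close> starts in
  \<open>y\<close>. Blocks have bounded length and every \<open>D\<close> consecutive ones contain a
  nonempty one, so lengths in \<open>z\<close> and \<open>y\<close> are linearly comparable.\<close>

lemma linearly_recurrent_substitution:
  fixes z :: "'a word" and g :: "'a \<Rightarrow> 'b list" and pos :: "nat \<Rightarrow> nat"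
  assumes rec: "linearly_recurrent D z"
    and pos0: "pos 0 = 0" and pos_Suc: "\<And>i. pos (Suc i) = pos i + length (g (z i))"
    and y: "\<And>i d. d < length (g (z i)) \<Longrightarrow> y (pos i + d) = g (z i) ! d"
    and unbounded: "\<And>N. \<exists>n. N \<le> pos n"
  obtains D' where "linearly_recurrent D' y"
proof -
  define B where "B = Max ((length \<circ> g) ` range z)"
  have B: "length (g (z i)) \<le> B" for i
    unfolding B_def using linearly_recurrent_finite_range[OF rec] by (intro Max_ge) auto
  have mono: "mono pos"
    by (rule incseq_SucI) (simp add: pos_Suc)
  have upper: "pos (i + n) \<le> pos i + B * n" for i n
  proof (induction n)
    case (Suc n)
    then show ?case
      using B[of "i + n"] by (simp add: pos_Suc)
  qed simp
  obtain b where b: "0 < length (g (z b))"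
  proof -
    obtain n where n: "1 \<le> pos n"
      using unbounded by blast
    have "pos n = 0" if "\<forall>b. length (g (z b)) = 0" for n
      using that by (induction n) (auto simp: pos0 pos_Suc)
    then show thesis
      using n that by (metis gr0I not_one_le_zero)
  qed
  \<comment> \<open>The letter \<open>z b\<close> has a nonempty image and recurs among any
    \<open>D\<close> consecutive positions.\<close>
  have step: "pos i + 1 \<le> pos (i + D)" for i
  proof -
    obtain k where k: "i \<le> k" "k + 1 \<le> i + D * 1" "\<And>d. d < 1 \<Longrightarrow> z (k + d) = z (b + d)"
      using linearly_recurrentE[OF rec] by metis
    have "z k = z b"
      using k(3)[of 0] by simp
    with b have "0 < length (g (z k))"
      by simp
    then have "pos i + 1 \<le> pos (Suc k)"
      using monoD[OF mono k(1)] pos_Suc[of k] by linarith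
    also have "\<dots> \<le> pos (i + D)"
      using k by (intro monoD[OF mono]) auto
    finally show ?thesis .
  qed
  have lower: "pos i + n \<le> pos (i + D * n)" for i n
  proof (induction n)
    case (Suc n)
    then show ?case
      using step[of "i + D * n"] by (simp add: algebra_simps)
  qed simp
  have block: "\<exists>i. pos i \<le> s \<and> s < pos (Suc i)" for s
  proof -
    define k where "k = (LEAST k. s < pos k)"
    obtain n where "Suc s \<le> pos n"
      using unbounded by blast
    then have "s < pos n"
      by simp
    then have k: "s < pos k"
      unfolding k_def by (rule LeastI)
    then have "k \<noteq> 0"
      using pos0 by (metis not_less_zero)
    then obtain i where i: "k = Suc i"
      using not0_implies_Suc by blast
    then have "\<not> s < pos i"
      using not_less_Least[of i "\<lambda>k. s < pos k"] by (simp add: k_def)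
    then show ?thesis
      using k i by (intro exI[of _ i]) simp
  qed
  \<comment> \<open>The offset \<open>e\<close> falls into a nonempty block \<open>h\<close>;
    monotonicity of \<open>pos\<close> puts \<open>h\<close> between \<open>i\<close> and
    \<open>i + l\<close>, where the letters of \<open>z\<close> agree and block starts differ by a
    constant shift.\<close>
  have copy: "y (pos i + e) = y (pos k + e)"
    if same: "\<And>d. d < l \<Longrightarrow> z (k + d) = z (i + d)" and e: "pos i + e < pos (i + l)" for i k l e
  proof -
    have shift: "pos (k + d) + pos i = pos (i + d) + pos k" if "d \<le> l" for d
      using that by (induction d) (auto simp: pos_Suc same)
    obtain h where h: "pos h \<le> pos i + e" "pos i + e < pos (Suc h)"
      using block by blast
    have "pos i < pos (Suc h)" "pos h < pos (i + l)"
      using h e by auto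
    then have "i < Suc h" "h < i + l"
      by (metis mono mono_strict_invE)+
    then have "i \<le> h" "h < i + l"
      by simp_all
    then obtain d where d: "h = i + d" "d < l"
      by (metis le_iff_add nat_add_left_cancel_less)
    define r where "r = pos i + e - pos h"
    have r: "pos i + e = pos (i + d) + r" "r < length (g (z (i + d)))"
      using h d by (auto simp: r_def pos_Suc)
    have "pos k + e = pos (k + d) + r"
      using shift[of d] r d by simp
    then show ?thesis
      using r y[of r "i + d"] y[of r "k + d"] same[OF d(2)] by simp
  qed
  \<comment> \<open>One \<open>B\<close> pays for moving on to the next block boundary; the rest
    bounds the output of \<open>D * l\<close> letters with \<open>l\<close> at most
    \<open>(1 + D) * n\<close>.\<close>
  define D' where "D' = B + B * (D * (1 + D))"
  have "linearly_recurrent D' y"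
    unfolding linearly_recurrent_def
  proof (intro allI)
    fix s s' n :: nat
    show "\<exists>k\<ge>s'. k + n \<le> s' + D' * n \<and> (\<forall>d<n. y (k + d) = y (s + d))"
    proof (cases "n = 0")
      case False
      obtain i where i: "pos i \<le> s" "s < pos (Suc i)"
        using block by blast
      obtain j where j: "pos j \<le> s'" "s' < pos (Suc j)"
        using block by blast
      \<comment> \<open>One block contains position \<open>s\<close>, and the next
        \<open>D * n\<close> blocks emit at least \<open>n\<close> letters.\<close>
      define l where "l = 1 + D * n"
      have "s + n < pos (Suc i) + n"
        using i by simp
      also have "\<dots> \<le> pos (i + l)"
        using lower[of "Suc i" n] by (simp add: l_def)
      finally have last: "s + n < pos (i + l)" .
      \<comment> \<open>Starting at \<open>Suc j\<close> rather than \<open>j\<close> ensures that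
        the copy does not begin before \<open>s'\<close>.\<close>
      obtain k where k: "Suc j \<le> k" "k + l \<le> Suc j + D * l" "\<And>d. d < l \<Longrightarrow> z (k + d) = z (i + d)"
        using linearly_recurrentE[OF rec] by metis
      have shift: "pos (k + d) + pos i = pos (i + d) + pos k" if "d \<le> l" for d
        using that by (induction d) (auto simp: pos_Suc k(3))
      define r where "r = s - pos i"
      have r: "s = pos i + r"
        using i by (simp add: r_def)
      have "pos k + r + n \<le> pos (k + l)"
        using shift[of l] last r by simp
      also have "\<dots> \<le> pos (Suc j + D * l)"
        using k(2) by (rule monoD[OF mono])
      also have "\<dots> \<le> pos (Suc j) + B * (D * l)"
        by (rule upper)
      also have "\<dots> \<le> s' + B + B * (D * l)"
        using j B[of j] by (simp add: pos_Suc)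
      also have "\<dots> \<le> s' + D' * n"
      proof -
        have "l \<le> (1 + D) * n"
          using False by (simp add: l_def)
        then have "B * (D * l) \<le> B * (D * ((1 + D) * n))"
          by (intro mult_le_mono2)
        moreover have "B \<le> B * n"
          using False by simp
        moreover have "D' * n = B * n + B * (D * ((1 + D) * n))"
          by (simp add: D'_def algebra_simps)
        ultimately show ?thesis
          by linarith
      qed
      finally have fits: "pos k + r + n \<le> s' + D' * n" .
      have "s' \<le> pos k + r"
        using j monoD[OF mono k(1)] by simp
      moreover have "y (pos k + r + d) = y (s + d)" if "d < n" for d
        using copy[of l k i "r + d"] k(3) last r that by (simp add: add.assoc)
      ultimately show ?thesis
        using fits by blast
    qed auto
  qed
  then show thesis by (rule that)
qed

section \<open>Transducer output as the image of the state-letter word\<close>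

text \<open>Approximations only grow, so a position written at step \<open>i\<close> first exists in
  \<open>output_upto M x (Suc i)\<close>, however many steps emit nothing.\<close>

lemma transduce_block:
  fixes M :: "('a, 'b, 'q) transducer" and x :: "'a word"
  assumes "d < length (output_fun M (run M x i) (x i))"
  shows "transduce M x (length (output_upto M x i) + d) = output_fun M (run M x i) (x i) ! d"
proof -
  let ?o = "output_upto M x"
  let ?j = "length (?o i) + d"
  have Suc: "?o (Suc n) = ?o n @ output_fun M (run M x n) (x n)" for n
    by (simp add: output_upto_def)
  have "length (?o n) \<le> length (?o i)" if "n \<le> i" for n
    using that by (induction rule: inc_induct) (auto simp: Suc)
  then have "Suc i \<le> n" if "?j < length (?o n)" for n
    using that by (meson add_lessD1 not_less not_less_eq_eq)
  then have "(LEAST n. ?j < length (?o n)) = Suc i"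
    using assms by (intro Least_equality) (auto simp: Suc)
  then show ?thesis
    using assms by (simp add: transduce_def Suc nth_append)
qed

theorem theorem11:
  fixes M :: "('a, 'b, 'q) transducer" and m :: nat and x :: "'a word"
  assumes "finite_state_transducer M"
    and "card (states M) = m"
    and "range x \<subseteq> input_alphabet M"
    and "eventually_linearly_almost_periodic x"
    and "infinite_output M x"
  shows "eventually_linearly_almost_periodic (transduce M x)"
proof -
  have fin: "finite (input_alphabet M)" "finite (states M)"
    and init: "init_state M \<in> states M"
    and next_closed: "\<And>q i. q \<in> states M \<Longrightarrow> next_state M q (x i) \<in> states M"
    using assms(1,3) by (auto simp: finite_state_transducer_def)
  obtain k where k: "linearly_almost_periodic (Omega_Words_Fun.suffix k x)"
    using assms(4) by (auto simp: eventually_linearly_almost_periodic_def)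
  let ?x = "Omega_Words_Fun.suffix k x"
  have "finite (range ?x)"
    using assms(3) by (intro finite_subset[OF _ fin(1)]) auto
  then obtain C where C: "linearly_recurrent C ?x"
    using linearly_almost_periodic_imp_linearly_recurrent[OF k] by blast
  \<comment> \<open>The automaton reads the recurrent suffix, and the state after \<open>k\<close>
    letters serves as its start state.\<close>
  interpret automaton_on_recurrent_word "states M" "next_state M" ?x C
    by unfold_locales (use fin next_closed C in auto)
  have run: "run M x i \<in> states M" for i
    by (induction i) (auto simp: init next_closed)
  have st: "st (run M x k) i = run M x (k + i)" for i
    by (induction i) auto
  obtain c D where D: "linearly_recurrent D
      (Omega_Words_Fun.suffix c (\<lambda>i. (st (run M x k) i, ?x i)))"
    using state_recurrence[OF run[of k]] by blast
  define a where "a = k + c"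
  define len where "len i = length (output_upto M x i)" for i
  define z where "z = (\<lambda>i. (run M x (a + i), x (a + i)))"
  \<comment> \<open>Positions are counted from \<open>len a\<close>, where the output of the dropped
    prefix of length \<open>a\<close> ends.\<close>
  define pos where "pos i = len (a + i) - len a" for i
  have len_Suc: "len (Suc i) = len i + length (output_fun M (run M x i) (x i))" for i
    by (simp add: len_def output_upto_def)
  have "len a \<le> len (a + i)" for i
    by (induction i) (auto simp: len_Suc)
  then have pos: "len (a + i) = len a + pos i" for i
    by (simp add: pos_def)
  have "Omega_Words_Fun.suffix c (\<lambda>i. (st (run M x k) i, ?x i)) = z"
    by (simp add: fun_eq_iff z_def st a_def add.assoc)
  with D have "linearly_recurrent D z"
    by simp
  moreover have "pos 0 = 0"
    by (simp add: pos_def)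
  moreover have "pos (Suc i) = pos i + length (case_prod (output_fun M) (z i))" for i
    using pos[of i] pos[of "Suc i"] len_Suc[of "a + i"] by (simp add: z_def)
  moreover have "Omega_Words_Fun.suffix (len a) (transduce M x) (pos i + d) = case_prod (output_fun M) (z i) ! d"
    if "d < length (case_prod (output_fun M) (z i))" for i d
    using transduce_block[of d M x "a + i"] that pos[of i] by (simp add: z_def len_def add.assoc)
  moreover have "\<exists>n. N \<le> pos n" for N
  proof -
    obtain n where n: "len a + N \<le> len n"
      using assms(5) unfolding infinite_output_def len_def by blast
    have "len n \<le> len (a + n)"
      by (induction a) (auto simp: len_Suc)
    then show ?thesis
      using n pos[of n] by (intro exI[of _ n]) simp
  qed
  ultimately obtain D' where "linearly_recurrent D' (Omega_Words_Fun.suffix (len a) (transduce M x))"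
    by (rule linearly_recurrent_substitution)
  then show ?thesis
    using linearly_recurrent_imp_linearly_almost_periodic
    by (auto simp: eventually_linearly_almost_periodic_def)
qed

end
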